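(* Let $w_1,w_2,w_3,w_4\in\mathbb{R}$ with $w_1+w_2+w_3+w_4=1$, let $\upsilon(r,s,t,u):=w_1r+w_2s+w_3t+w_4u$, and for a real array $(b_{ij})_{1\le i,j\le4}$ let \[\upsilon_2\big((b_{ij})\big):=\upsilon\big(\upsilon(b_{11},b_{12},b_{13},b_{14}),\upsilon(b_{21},b_{22},b_{23},b_{24}),\upsilon(b_{31},b_{32},b_{33},b_{34}),\upsilon(b_{41},b_{42},b_{43},b_{44})\big).\] Then both row transformations and column transformations of the array $(b_{ij})$ preserve the value of $\upsilon_2$.
   Context: A row transformation of $(b_{ij})$ consists of choosing $i\in\{1,2,3,4\}$ and $d_i\in\mathbb{R}$ and replacing each of the four entries $x\in\{b_{i1},b_{i2},b_{i3},b_{i4}\}$ of row $i$ by $\upsilon(b_{i1},b_{i2},b_{i3},b_{i4})+d_i\big(x-\upsilon(b_{i1},b_{i2},b_{i3},b_{i4})\big)$, leaving the other entries unchanged. A column transformation is defined in the same way using the entries $b_{1i},b_{2i},b_{3i},b_{4i}$ of column $i$ and the value $\upsilon(b_{1i},b_{2i},b_{3i},b_{4i})$. *)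

theory Defs
  imports "HOL-Analysis.Analysis"
begin

(* The four weights are the components of w; arrays are 4 x 4 matrices with b_ij = b $ i $ j.
   The numerals 1, 2, 3, 4 are exactly the four distinct elements of the index type 4
   (the numeral 4 denotes its element 0; see exhaust_4). *)

definition upsilon :: "real ^ 4 \<Rightarrow> real \<Rightarrow> real \<Rightarrow> real \<Rightarrow> real \<Rightarrow> real" where
  "upsilon w r s t u = w $ 1 * r + w $ 2 * s + w $ 3 * t + w $ 4 * u"

definition upsilon2 :: "real ^ 4 \<Rightarrow> real ^ 4 ^ 4 \<Rightarrow> real" where
  "upsilon2 w b =
     upsilon w
       (upsilon w (b $ 1 $ 1) (b $ 1 $ 2) (b $ 1 $ 3) (b $ 1 $ 4))
       (upsilon w (b $ 2 $ 1) (b $ 2 $ 2) (b $ 2 $ 3) (b $ 2 $ 4))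
       (upsilon w (b $ 3 $ 1) (b $ 3 $ 2) (b $ 3 $ 3) (b $ 3 $ 4))
       (upsilon w (b $ 4 $ 1) (b $ 4 $ 2) (b $ 4 $ 3) (b $ 4 $ 4))"

definition row_transformation :: "real ^ 4 \<Rightarrow> 4 \<Rightarrow> real \<Rightarrow> real ^ 4 ^ 4 \<Rightarrow> real ^ 4 ^ 4" where
  "row_transformation w i d b =
     (let v = upsilon w (b $ i $ 1) (b $ i $ 2) (b $ i $ 3) (b $ i $ 4)
      in \<chi> k l. if k = i then v + d * (b $ k $ l - v) else b $ k $ l)"

definition column_transformation :: "real ^ 4 \<Rightarrow> 4 \<Rightarrow> real \<Rightarrow> real ^ 4 ^ 4 \<Rightarrow> real ^ 4 ^ 4" where
  "column_transformation w i d b =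
     (let v = upsilon w (b $ 1 $ i) (b $ 2 $ i) (b $ 3 $ i) (b $ 4 $ i)
      in \<chi> k l. if l = i then v + d * (b $ k $ l - v) else b $ k $ l)"

end

(* A row transformation moves the entries of a row along an affine map that fixes their weighted
   mean, so it does not change any row mean; upsilon2 depends on the row means only.
   Since upsilon2 is invariant under transposition, the same holds for columns. *)

theory Submission
  imports Defs
begin

lemma upsilon_dilation_about_mean:
  assumes "w $ 1 + w $ 2 + w $ 3 + w $ 4 = 1" and v: "v = upsilon w r s t u"
  shows "upsilon w (v + d * (r - v)) (v + d * (s - v)) (v + d * (t - v)) (v + d * (u - v)) = v"
proof -
  \<comment> \<open>Each argument is \<open>(1 - d) * v + d * x\<close>; by linearity the constant
    part collects the sum of the weights, which becomes 1 in the next step.\<close>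
  have "upsilon w (v + d * (r - v)) (v + d * (s - v)) (v + d * (t - v)) (v + d * (u - v))
      = (1 - d) * v * (w $ 1 + w $ 2 + w $ 3 + w $ 4) + d * upsilon w r s t u"
    unfolding upsilon_def by algebra
  also have "\<dots> = v"
    by (simp add: assms(1) flip: v) (simp add: algebra_simps)
  finally show ?thesis .
qed

text \<open>For \<open>k = i\<close> this is the dilation about the mean; any other row is
  untouched.\<close>

lemma upsilon_row_transformation:
  fixes b :: "real ^ 4 ^ 4" and i :: 4 and d :: real
  assumes "w $ 1 + w $ 2 + w $ 3 + w $ 4 = 1"
  defines "c \<equiv> row_transformation w i d b"
  shows "upsilon w (c $ k $ 1) (c $ k $ 2) (c $ k $ 3) (c $ k $ 4)
       = upsilon w (b $ k $ 1) (b $ k $ 2) (b $ k $ 3) (b $ k $ 4)"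
  using upsilon_dilation_about_mean[OF assms(1) refl]
  by (simp add: c_def row_transformation_def Let_def)

lemma upsilon2_row_transformation:
  assumes "w $ 1 + w $ 2 + w $ 3 + w $ 4 = 1"
  shows "upsilon2 w (row_transformation w i d b) = upsilon2 w b"
  unfolding upsilon2_def by (simp only: upsilon_row_transformation[OF assms])

text \<open>Expanded, \<open>upsilon2 w b\<close> is the double sum of
  \<open>w $ k * w $ l * b $ k $ l\<close>, whose coefficients are symmetric in \<open>k\<close> and
  \<open>l\<close>.\<close>

lemma upsilon2_transpose: "upsilon2 w (transpose b) = upsilon2 w b"
  by (simp add: upsilon2_def upsilon_def transpose_def algebra_simps)

lemma column_transformation_eq_transpose:
  "column_transformation w i d b = transpose (row_transformation w i d (transpose b))"
  by (simp add: column_transformation_def row_transformation_def transpose_def Let_def vec_eq_iff)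

theorem mainTheorem9:
  fixes w :: "real ^ 4" and b :: "real ^ 4 ^ 4"
  assumes "w $ 1 + w $ 2 + w $ 3 + w $ 4 = 1"
  shows "(\<forall>i d. upsilon2 w (row_transformation w i d b) = upsilon2 w b) \<and>
         (\<forall>i d. upsilon2 w (column_transformation w i d b) = upsilon2 w b)"
  by (simp add: column_transformation_eq_transpose upsilon2_transpose
      upsilon2_row_transformation[OF assms])

end
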